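(* Let $k \ge 2$ be an integer. For a set $V = \{v_0,\dots,v_k\} \subset \mathbf{R}^2$ of $k+1$ distinct unit vectors, let $\mathrm{D}(V) = \min\{|\det(v_i,v_j)| : 0 \le i < j \le k\}$. Then, among all sets $V$ of $k+1$ distinct unit vectors in $\mathbf{R}^2$, $\mathrm{D}(V)$ is maximal when $v_0,\dots,v_k$ are consecutive vertices of a regular $(2k+2)$-gon inscribed in the unit circle $S^1$, and for that maximal configuration $$\mathrm{D}(V) = \sin\left(\frac{\pi}{k+1}\right).$$ That is, every set $V$ of $k+1$ distinct unit vectors in $\mathbf{R}^2$ satisfies $\mathrm{D}(V) \le \sin(\pi/(k+1))$, with equality whenever $v_0,\dots,v_k$ are consecutive vertices of a regular $(2k+2)$-gon inscribed in $S^1$.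
   Context: $S^1$ is the unit circle in $\mathbf{R}^2$ centered at the origin, and $\det(v_i,v_j)$ is the determinant of the $2\times 2$ matrix with columns $v_i, v_j$. If $v_0,\dots,v_k$ are vertices of a convex $p$-gon inscribed in $S^1$ with $p>k$, they are called consecutive vertices if for all $0 \le j < k$, $v_{j+1}$ is the vertex of the $p$-gon adjacent to $v_j$ in the counterclockwise direction. *)

theory Defs
  imports "HOL-Analysis.Analysis"
begin

definition det_cols :: "real^2 \<Rightarrow> real^2 \<Rightarrow> real" where
  "det_cols u w = det (transpose (vector [u, w] :: real^2^2))"

lemma det_cols_eq: "det_cols u w = u $ 1 * w $ 2 - w $ 1 * u $ 2"
  by (simp add: det_cols_def det_2 transpose_def)

lemma column_det_cols:
  "column 1 (transpose (vector [u, w] :: real^2^2)) = u"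
  "column 2 (transpose (vector [u, w] :: real^2^2)) = w"
  by (simp_all add: column_def transpose_def vec_eq_iff)

text \<open>The absolute value is symmetric in \<open>u\<close> and \<open>w\<close>, so for a set it suffices to range over
  pairs of different elements; \<open>min_det_indexed\<close> is the formula in terms of an enumeration.\<close>

definition min_det :: "(real^2) set \<Rightarrow> real" where
  "min_det V = Min {\<bar>det_cols u w\<bar> | u w. u \<in> V \<and> w \<in> V \<and> u \<noteq> w}"

lemma min_det_indexed:
  fixes v :: "nat \<Rightarrow> real^2"
  assumes "inj_on v {0..k}"
  shows "min_det (v ` {0..k}) = Min {\<bar>det_cols (v i) (v j)\<bar> | i j. 0 \<le> i \<and> i < j \<and> j \<le> k}"
proof -
  have sym: "\<bar>det_cols u w\<bar> = \<bar>det_cols w u\<bar>" for u w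
    by (simp add: det_cols_eq abs_minus_commute mult.commute)
  have "{\<bar>det_cols u w\<bar> | u w. u \<in> v ` {0..k} \<and> w \<in> v ` {0..k} \<and> u \<noteq> w}
      = {\<bar>det_cols (v i) (v j)\<bar> | i j. 0 \<le> i \<and> i < j \<and> j \<le> k}" (is "?L = ?R")
  proof
    show "?L \<subseteq> ?R"
    proof
      fix d assume "d \<in> ?L"
      then obtain i j where ij: "i \<le> k" "j \<le> k" "i \<noteq> j" "d = \<bar>det_cols (v i) (v j)\<bar>"
        by (smt (verit) atLeastAtMost_iff imageE mem_Collect_eq)
      show "d \<in> ?R"
      proof (cases "i < j")
        case True
        then show ?thesis using ij by - (rule CollectI, rule exI[of _ i], rule exI[of _ j], simp)
      next
        case False
        then have "j < i" using ij by simp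
        then show ?thesis using ij sym[of "v i" "v j"]
            by - (rule CollectI, rule exI[of _ j], rule exI[of _ i], simp)
      qed
    qed
  next
    show "?R \<subseteq> ?L"
    proof
      fix d assume "d \<in> ?R"
      then obtain i j where ij: "i < j" "j \<le> k" "d = \<bar>det_cols (v i) (v j)\<bar>"
        by blast
      then have "v i \<noteq> v j"
        using inj_on_eq_iff[OF assms, of i j] by simp
      moreover have "v i \<in> v ` {0..k}" "v j \<in> v ` {0..k}"
        using ij by simp_all
      ultimately show "d \<in> ?L"
        using ij by blast
    qed
  qed
  then show ?thesis by (simp add: min_det_def)
qed

text \<open>A convex \<open>p\<close>-gon is represented by its vertex set \<open>P\<close>; the polygon itself is
  \<open>convex hull P\<close>.\<close>

definition convex_polygon :: "nat \<Rightarrow> (real^2) set \<Rightarrow> bool" where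
  "convex_polygon p P \<longleftrightarrow> 3 \<le> p \<and> finite P \<and> card P = p \<and>
     {x. x extreme_point_of (convex hull P)} = P"

text \<open>\<open>w\<close> is adjacent to \<open>u\<close> in the counterclockwise direction iff the polygon lies to the left
  of the directed line from \<open>u\<close> to \<open>w\<close>, touching it only in the edge from \<open>u\<close> to \<open>w\<close>.\<close>

definition ccw_adjacent :: "(real^2) set \<Rightarrow> real^2 \<Rightarrow> real^2 \<Rightarrow> bool" where
  "ccw_adjacent P u w \<longleftrightarrow> u \<in> P \<and> w \<in> P \<and> u \<noteq> w \<and>
     (\<forall>x \<in> P - {u, w}. det_cols (w - u) (x - u) > 0)"

definition angle_at :: "real^2 \<Rightarrow> real^2 \<Rightarrow> real^2 \<Rightarrow> real" where
  "angle_at u w x = arccos (((u - w) \<bullet> (x - w)) / (norm (u - w) * norm (x - w)))"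

definition regular_polygon :: "nat \<Rightarrow> (real^2) set \<Rightarrow> bool" where
  "regular_polygon p P \<longleftrightarrow> convex_polygon p P \<and>
     (\<exists>s. \<forall>u w. ccw_adjacent P u w \<longrightarrow> dist u w = s) \<and>
     (\<exists>a. \<forall>u w x. ccw_adjacent P u w \<and> ccw_adjacent P w x \<longrightarrow> angle_at u w x = a)"

definition consecutive_vertices :: "(real^2) set \<Rightarrow> nat \<Rightarrow> (nat \<Rightarrow> real^2) \<Rightarrow> bool" where
  "consecutive_vertices P k v \<longleftrightarrow> k < card P \<and> (\<forall>j\<le>k. v j \<in> P) \<and>
     (\<forall>j<k. ccw_adjacent P (v j) (v (Suc j)))"

definition unit_vector_set :: "nat \<Rightarrow> (real^2) set \<Rightarrow> bool" where
  "unit_vector_set n V \<longleftrightarrow> finite V \<and> card V = n \<and> (\<forall>x\<in>V. norm x = 1)"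

end

theory Submission
  imports Defs
begin

text \<open>Write \<open>n = k + 1\<close> and measure the angles of the given vectors modulo \<open>\<pi>\<close>, starting
  from one of them. If some angle is at distance at most \<open>\<pi> / n\<close> from \<open>0\<close> or \<open>\<pi>\<close>, its vector and
  the first one have a small determinant. Otherwise \<open>n - 1\<close> angles lie strictly between \<open>\<pi> / n\<close>
  and \<open>\<pi> - \<pi> / n\<close>, an interval made of \<open>n - 2\<close> pieces of length \<open>\<pi> / n\<close>, so two of them differ by
  less than \<open>\<pi> / n\<close>.

  For an inscribed polygon, equal sides \<open>2 sin (\<gamma> / 2)\<close> leave only two values \<open>g\<close> and
  \<open>2 \<pi> - g\<close> for the central angles \<open>\<gamma>\<close>, and the larger one leaves no room for a third vertex.
  Hence all central angles agree, and the determinants of consecutive vertices are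
  \<open>sin (m \<pi> / n)\<close> with \<open>0 < m < n\<close>.\<close>

section \<open>Unit vectors and angles\<close>

definition unit_dir :: "real \<Rightarrow> real^2" where
  "unit_dir t = vector [cos t, sin t]"

lemma unit_dir_nth [simp]: "unit_dir t $ 1 = cos t" "unit_dir t $ 2 = sin t"
  by (simp_all add: unit_dir_def)

lemma unit_dir_eq_iff: "unit_dir a = unit_dir b \<longleftrightarrow> cos a = cos b \<and> sin a = sin b"
  by (auto simp: vec_eq_iff forall_2)

lemma norm_unit_dir [simp]: "norm (unit_dir t) = 1"
  by (simp add: norm_vec_def L2_set_def UNIV_2)

lemma unit_dir_add_2pi [simp]: "unit_dir (t + 2 * pi) = unit_dir t"
  by (simp add: unit_dir_eq_iff)

lemma unit_dir_add_2pi_int: "unit_dir (t + 2 * pi * of_int m) = unit_dir t"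
  by (simp add: unit_dir_eq_iff sin_add cos_add)

text \<open>Shifting an angle by whole turns moves it into any half-open window of length
  \<open>2 * pi\<close>. The start \<open>a\<close> is left free so that angles can be counted
  counterclockwise from any chosen vertex.\<close>

lemma unit_dir_surj:
  assumes "norm x = 1"
  obtains t where "a \<le> t" "t < a + 2 * pi" "x = unit_dir t"
proof -
  have "(x $ 1)\<^sup>2 + (x $ 2)\<^sup>2 = 1"
    using assms by (simp add: norm_vec_def L2_set_def UNIV_2)
  then obtain s where s: "x $ 1 = cos s" "x $ 2 = sin s"
    using sincos_total_2pi by metis
  define m where "m = \<lfloor>(s - a) / (2 * pi)\<rfloor>"
  define t where "t = s + 2 * pi * of_int (- m)"
  have "of_int m \<le> (s - a) / (2 * pi)" "(s - a) / (2 * pi) < of_int m + 1"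
    unfolding m_def by linarith+
  then have "of_int m * (2 * pi) \<le> s - a" "s - a < (of_int m + 1) * (2 * pi)"
    by (simp_all add: pos_le_divide_eq pos_divide_less_eq)
  then have "a \<le> t" "t < a + 2 * pi"
    by (simp_all add: t_def algebra_simps)
  moreover have "x = unit_dir t"
    unfolding t_def unit_dir_add_2pi_int by (simp add: vec_eq_iff forall_2 s)
  ultimately show thesis
    using that by blast
qed

lemma det_cols_unit_dir: "det_cols (unit_dir a) (unit_dir b) = sin (b - a)"
  by (simp add: det_cols_eq sin_diff mult.commute)

text \<open>Twice the signed area of an inscribed triangle. The factored form lets the orientation
  be read off from the order of the three angles.\<close>

lemma det_cols_unit_dir_diff:
  "det_cols (unit_dir b - unit_dir a) (unit_dir c - unit_dir a)
    = 4 * sin ((b - a) / 2) * sin ((c - b) / 2) * sin ((c - a) / 2)"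
proof -
  \<comment> \<open>In the half angles the claim becomes a polynomial identity in sines and cosines
    modulo \<open>sin^2 + cos^2 = 1\<close>, which \<open>algebra\<close> decides.\<close>
  define h k where "h = (c - b) / 2" and "k = (b - a) / 2"
  have eqs: "c - b = 2 * h" "b - a = 2 * k" "c - a = 2 * (h + k)"
    by (simp_all add: h_def k_def field_simps)
  have "det_cols (unit_dir b - unit_dir a) (unit_dir c - unit_dir a)
      = sin (c - b) + sin (b - a) - sin (c - a)"
    by (simp add: det_cols_eq sin_diff algebra_simps)
  also have "\<dots> = 4 * sin k * sin h * sin (h + k)"
    unfolding eqs sin_double cos_add sin_add
    using sin_cos_squared_add[of h] sin_cos_squared_add[of k] by algebra
  moreover have "(c - a) / 2 = h + k"
    by (simp add: eqs)
  ultimately show ?thesis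
    by (simp only: h_def k_def)
qed

lemma dist_unit_dir: "dist (unit_dir a) (unit_dir b) = 2 * \<bar>sin ((b - a) / 2)\<bar>"
proof -
  define k where "k = (b - a) / 2"
  have b: "b = a + 2 * k"
    by (simp add: k_def field_simps)
  have "(dist (unit_dir a) (unit_dir b))\<^sup>2 = (cos a - cos b)\<^sup>2 + (sin a - sin b)\<^sup>2"
    by (simp add: dist_norm norm_vec_def L2_set_def UNIV_2)
  also have "\<dots> = (2 * \<bar>sin k\<bar>)\<^sup>2"
    unfolding b sin_add cos_add sin_double cos_double power_mult_distrib power2_abs
    using sin_cos_squared_add[of a] sin_cos_squared_add[of k] by algebra
  finally have "dist (unit_dir a) (unit_dir b) = 2 * \<bar>sin k\<bar>"
    by (rule power2_eq_imp_eq) auto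
  then show ?thesis
    by (simp only: k_def)
qed

text \<open>Equal points have chord length 0, and half the difference of the angles lies strictly
  between \<open>- pi\<close> and \<open>pi\<close>, where the sine vanishes only at 0.\<close>

lemma inj_on_unit_dir: "inj_on unit_dir {a..<a + 2 * pi}"
proof (rule inj_onI)
  fix s t assume st: "s \<in> {a..<a + 2 * pi}" "t \<in> {a..<a + 2 * pi}" "unit_dir s = unit_dir t"
  then have "sin ((t - s) / 2) = 0"
    using dist_unit_dir[of s t] by simp
  moreover have "- pi < (t - s) / 2" "(t - s) / 2 < pi"
    using st by auto
  ultimately show "s = t"
    using sin_eq_0_pi by fastforce
qed

section \<open>The upper bound\<close>

lemma finite_abs_det_cols:
  assumes "finite V"
  shows "finite {\<bar>det_cols u w\<bar> | u w. u \<in> V \<and> w \<in> V \<and> u \<noteq> w}"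
proof (rule finite_subset)
  show "{\<bar>det_cols u w\<bar> | u w. u \<in> V \<and> w \<in> V \<and> u \<noteq> w}
      \<subseteq> (\<lambda>(u, w). \<bar>det_cols u w\<bar>) ` (V \<times> V)"
    by auto
qed (use assms in simp)

lemma min_det_le:
  assumes "finite V" "u \<in> V" "w \<in> V" "u \<noteq> w"
  shows "min_det V \<le> \<bar>det_cols u w\<bar>"
  unfolding min_det_def using assms by (intro Min_le finite_abs_det_cols) auto

lemma abs_sin_le:
  fixes g x :: real
  assumes "\<bar>x\<bar> \<le> g" "g \<le> pi / 2"
  shows "\<bar>sin x\<bar> \<le> sin g"
proof -
  have "\<bar>sin x\<bar> = sin \<bar>x\<bar>"
    using assms sin_ge_zero[of "\<bar>x\<bar>"] by (cases "0 \<le> x") auto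
  also have "\<dots> \<le> sin g"
    using assms by (intro sin_monotone_2pi_le) auto
  finally show ?thesis .
qed

text \<open>A direction in the second half of the turn is the negative of one in the first half.
  Absolute determinants ignore signs, so half a turn of angles is enough for the upper
  bound.\<close>

lemma unit_dir_mod_pi:
  assumes "norm w = 1"
  obtains t where "0 \<le> t" "t < pi" "w = unit_dir (a + t) \<or> w = - unit_dir (a + t)"
proof -
  obtain s where s: "a \<le> s" "s < a + 2 * pi" "w = unit_dir s"
    using unit_dir_surj[OF assms] by blast
  show thesis
  proof (cases "s < a + pi")
    case True
    then show thesis
      using s that[of "s - a"] by simp
  next
    case False
    have "w = - unit_dir (a + (s - a - pi))"
      by (simp add: s vec_eq_iff forall_2)
    then show thesis
      using s False that[of "s - a - pi"] by simp
  qed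
qed

lemma min_det_le_sin:
  fixes k :: nat
  assumes "k \<ge> 2" and V: "unit_vector_set (k + 1) V"
  shows "min_det V \<le> sin (pi / real (k + 1))"
proof -
  have fin: "finite V" and cV: "card V = k + 1" and unit: "\<And>x. x \<in> V \<Longrightarrow> norm x = 1"
    using V by (auto simp: unit_vector_set_def)
  define g where "g = pi / real (k + 1)"
  have g: "g > 0" "g \<le> pi / 2" "real (k + 1) * g = pi"
    using assms(1) by (simp_all add: g_def divide_le_eq)
  obtain u where u: "u \<in> V"
    using cV by fastforce
  obtain a where a: "u = unit_dir a"
    using unit_dir_surj[OF unit[OF u]] by metis
  define W where "W = V - {u}"
  have W: "finite W" "card W = k"
    using fin cV u by (auto simp: W_def)
  have "\<forall>w\<in>W. \<exists>t. 0 \<le> t \<and> t < pi \<and> (w = unit_dir (a + t) \<or> w = - unit_dir (a + t))"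
    using unit unit_dir_mod_pi[of _ a] unfolding W_def by (metis DiffD1)
  then obtain \<theta> where \<theta>: "\<And>w. w \<in> W \<Longrightarrow> 0 \<le> \<theta> w" "\<And>w. w \<in> W \<Longrightarrow> \<theta> w < pi"
    and \<theta>_eq: "\<And>w. w \<in> W \<Longrightarrow> w = unit_dir (a + \<theta> w) \<or> w = - unit_dir (a + \<theta> w)"
    by metis
  have det_minus: "\<bar>det_cols x (- y)\<bar> = \<bar>det_cols x y\<bar>" "\<bar>det_cols (- x) y\<bar> = \<bar>det_cols x y\<bar>"
    for x y :: "real^2"
    by (simp_all add: det_cols_eq abs_minus_commute)
  have det_u: "\<bar>det_cols u w\<bar> = \<bar>sin (\<theta> w)\<bar>" if "w \<in> W" for w
    using \<theta>_eq[OF that]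
    by (metis a det_cols_unit_dir det_minus(1) add_diff_cancel_left')
  have det_W: "\<bar>det_cols w x\<bar> = \<bar>sin (\<theta> x - \<theta> w)\<bar>" if "w \<in> W" "x \<in> W" for w x
  proof -
    have "\<bar>det_cols w x\<bar> = \<bar>det_cols (unit_dir (a + \<theta> w)) (unit_dir (a + \<theta> x))\<bar>"
      using \<theta>_eq[OF that(1)] \<theta>_eq[OF that(2)] det_minus by metis
    then show ?thesis
      by (simp add: det_cols_unit_dir)
  qed
  have "\<exists>x\<in>V. \<exists>w\<in>V. x \<noteq> w \<and> \<bar>det_cols x w\<bar> \<le> sin g"
  \<comment> \<open>The first case also covers \<open>- u\<close>, whose angle modulo
    \<open>pi\<close> is 0.\<close>
  proof (cases "\<exists>w\<in>W. \<theta> w \<le> g \<or> pi - g \<le> \<theta> w")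
    case True
    then obtain w where w: "w \<in> W" "\<theta> w \<le> g \<or> pi - g \<le> \<theta> w"
      by blast
    have "\<bar>sin (\<theta> w)\<bar> \<le> sin g"
    proof (cases "\<theta> w \<le> g")
      case True
      then show ?thesis
        using \<theta>[OF w(1)] g by (intro abs_sin_le) auto
    next
      case False
      then have "\<bar>sin (pi - \<theta> w)\<bar> \<le> sin g"
        using \<theta>[OF w(1)] w g by (intro abs_sin_le) auto
      then show ?thesis
        by simp
    qed
    then show ?thesis
      using det_u[OF w(1)] w(1) u by (metis DiffE W_def singletonI)
  next
    case False
    define f where "f w = \<lfloor>\<theta> w / g\<rfloor>" for w
    \<comment> \<open>Since \<open>pi - g = k * g\<close>, each quotient lies strictly between 1 and
      \<open>k\<close>. Strictness at the upper end excludes the index \<open>k\<close>, which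
      leaves \<open>k - 1\<close> pieces for the \<open>k\<close> vectors in
      \<open>W\<close>.\<close>
    have "f ` W \<subseteq> {1..<int k}"
    proof (rule image_subsetI)
      fix w assume "w \<in> W"
      then have "g < \<theta> w" "\<theta> w < pi - g"
        using False by auto
      then have "1 < \<theta> w / g" "\<theta> w / g < real k"
        using g by (auto simp: pos_less_divide_eq pos_divide_less_eq algebra_simps)
      then show "f w \<in> {1..<int k}"
        unfolding f_def by (simp add: floor_less_iff le_floor_iff)
    qed
    then have "card (f ` W) \<le> card {1..<int k}"
      by (intro card_mono) auto
    then have "card (f ` W) < card W"
      using W assms(1) by simp
    then have "\<not> inj_on f W"
      using pigeonhole by blast
    then obtain w x where wx: "w \<in> W" "x \<in> W" "w \<noteq> x" "f w = f x"
      by (auto simp: inj_on_def)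
    then have "\<bar>\<theta> x / g - \<theta> w / g\<bar> < 1"
      unfolding f_def by linarith
    then have "\<bar>\<theta> x - \<theta> w\<bar> \<le> g"
      using g(1) by (simp add: diff_divide_distrib[symmetric] abs_divide pos_divide_less_eq)
    then have "\<bar>det_cols w x\<bar> \<le> sin g"
      unfolding det_W[OF wx(1,2)] using g by (intro abs_sin_le)
    then show ?thesis
      using wx unfolding W_def by blast
  qed
  then show ?thesis
    unfolding g_def[symmetric] using min_det_le[OF fin] by (meson order_trans)
qed

section \<open>Inscribed regular polygons\<close>

text \<open>For a third vertex at angle \<open>c\<close> between \<open>a\<close> and
  \<open>a + 2 * pi\<close>, two of the sine factors of the determinant are positive, so its sign is
  that of \<open>sin ((c - b) / 2)\<close>. Lying to the left of the edge thus means lying past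
  \<open>b\<close>, not on the arc from \<open>a\<close> to \<open>b\<close>.\<close>

lemma ccw_adjacent_unit_dir_iff:
  assumes "unit_dir a \<in> P" "unit_dir b \<in> P" "a < b" "b < a + 2 * pi" "P \<subseteq> sphere 0 1"
  shows "ccw_adjacent P (unit_dir a) (unit_dir b)
    \<longleftrightarrow> (\<forall>c. a < c \<and> c < b \<longrightarrow> unit_dir c \<notin> P)"
proof -
  have ne: "unit_dir s \<noteq> unit_dir t" if "s < t" "s \<ge> a" "t < a + 2 * pi" for s t
    using inj_onD[OF inj_on_unit_dir[of a], of s t] that by auto
  have sgn: "det_cols (unit_dir b - unit_dir a) (unit_dir c - unit_dir a) > 0 \<longleftrightarrow> b < c"
    if "a < c" "c < a + 2 * pi" for c
  proof -
    have "sin ((b - a) / 2) > 0" "sin ((c - a) / 2) > 0"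
      using assms(3,4) that by (auto intro!: sin_gt_zero)
    moreover have "sin ((c - b) / 2) > 0 \<longleftrightarrow> b < c"
    proof (cases "b < c")
      case True
      then show ?thesis
        using assms that by (auto intro!: sin_gt_zero)
    next
      case False
      then have "sin ((b - c) / 2) \<ge> 0"
        using assms that by (intro sin_ge_zero) auto
      moreover have "sin ((c - b) / 2) = - sin ((b - c) / 2)"
        by (metis minus_diff_eq minus_divide_left sin_minus)
      ultimately show ?thesis
        using False by simp
    qed
    ultimately show ?thesis
      unfolding det_cols_unit_dir_diff by (simp add: zero_less_mult_iff)
  qed
  show ?thesis
  proof
    assume adj: "ccw_adjacent P (unit_dir a) (unit_dir b)"
    show "\<forall>c. a < c \<and> c < b \<longrightarrow> unit_dir c \<notin> P"
    proof (intro allI impI notI)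
      fix c assume c: "a < c \<and> c < b" "unit_dir c \<in> P"
      then have "unit_dir c \<in> P - {unit_dir a, unit_dir b}"
        using ne[of a c] ne[of c b] assms by auto
      then have "b < c"
        using adj sgn[of c] c assms(4) by (auto simp: ccw_adjacent_def)
      then show False
        using c by simp
    qed
  next
    assume none: "\<forall>c. a < c \<and> c < b \<longrightarrow> unit_dir c \<notin> P"
    have "det_cols (unit_dir b - unit_dir a) (x - unit_dir a) > 0"
      if x: "x \<in> P - {unit_dir a, unit_dir b}" for x
    proof -
      have "norm x = 1"
        using x assms(5) by auto
      then obtain c where c: "a \<le> c" "c < a + 2 * pi" "x = unit_dir c"
        using unit_dir_surj by metis
      then have "c \<noteq> a" "c \<noteq> b" "\<not> (a < c \<and> c < b)"
        using x none by auto
      then show ?thesis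
        using sgn[of c] c by auto
    qed
    then show "ccw_adjacent P (unit_dir a) (unit_dir b)"
      using assms ne[of a b] by (auto simp: ccw_adjacent_def)
  qed
qed

text \<open>The angles of the other vertices within one turn form a set that is finite by
  injectivity and nonempty because a second vertex exists; its minimum is the angle sought.\<close>

lemma next_angle_exists:
  assumes "finite P" "card P \<ge> 2" "P \<subseteq> sphere 0 1" "unit_dir a \<in> P"
  obtains b where "a < b" "b < a + 2 * pi" "unit_dir b \<in> P"
    "\<And>c. a < c \<Longrightarrow> c < b \<Longrightarrow> unit_dir c \<notin> P"
proof -
  define B where "B = {c. a < c \<and> c < a + 2 * pi \<and> unit_dir c \<in> P}"
  have "inj_on unit_dir B"
    by (rule inj_on_subset[OF inj_on_unit_dir[of a]]) (auto simp: B_def)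
  moreover have "unit_dir ` B \<subseteq> P"
    by (auto simp: B_def)
  ultimately have fin: "finite B"
    using assms(1) inj_on_finite by blast
  have "\<exists>x\<in>P. x \<noteq> unit_dir a"
  proof (rule ccontr)
    assume "\<not> ?thesis"
    then have "P \<subseteq> {unit_dir a}"
      by auto
    then have "card P \<le> 1"
      using card_mono[of "{unit_dir a}" P] by simp
    then show False
      using assms(2) by simp
  qed
  then obtain x where x: "x \<in> P" "x \<noteq> unit_dir a" "norm x = 1"
    using assms(3) by auto
  then obtain c where "a \<le> c" "c < a + 2 * pi" "x = unit_dir c"
    using unit_dir_surj by metis
  then have "c \<in> B"
    using x by (cases "c = a") (auto simp: B_def)
  then have "Min B \<in> B" and le: "\<And>c. c \<in> B \<Longrightarrow> Min B \<le> c"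
    using fin by (auto intro!: Min_in)
  show thesis
  proof
    show "a < Min B" "Min B < a + 2 * pi" "unit_dir (Min B) \<in> P"
      using \<open>Min B \<in> B\<close> by (auto simp: B_def)
    show "unit_dir c \<notin> P" if "a < c" "c < Min B" for c
      using le[of c] that \<open>Min B < a + 2 * pi\<close> by (auto simp: B_def)
  qed
qed

lemma sin_eq_imp_angle:
  assumes "0 < x" "x < pi" "sin x = sin y" "0 \<le> y" "y \<le> pi / 2"
  shows "x = y \<or> x = pi - y"
proof (cases "x \<le> pi / 2")
  case True
  then show ?thesis
    using assms sin_inj_pi[of x y] by auto
next
  case False
  then show ?thesis
    using assms sin_inj_pi[of "pi - x" y] by auto
qed

text \<open>Once all gaps between successive angles equal one \<open>g\<close>, walking in steps of
  \<open>g\<close> visits every vertex, and closing up after a full turn with \<open>p\<close>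
  vertices fixes \<open>g\<close>.\<close>

lemma equilateral_inscribed_gap:
  assumes "finite P" "card P = p" "p \<ge> 3" "P \<subseteq> sphere 0 1"
    and side: "\<And>u w. ccw_adjacent P u w \<Longrightarrow> dist u w = s"
    and adj: "ccw_adjacent P (unit_dir a) w"
  shows "w = unit_dir (a + 2 * pi / real p)"
proof -
  \<comment> \<open>The central angle, at most \<open>pi\<close>, that belongs to a chord of length
    \<open>s\<close>.\<close>
  define g where "g = 2 * arcsin (s / 2)"
  \<comment> \<open>Adjacency lifted from points to real angles, so that gaps can be added without
    reducing modulo \<open>2 * pi\<close>.\<close>
  define consec where "consec a b \<longleftrightarrow> a < b \<and> b < a + 2 * pi \<and> unit_dir a \<in> P \<and> unit_dir b \<in> P
    \<and> (\<forall>c. a < c \<and> c < b \<longrightarrow> unit_dir c \<notin> P)" for a b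
  have aP: "unit_dir a \<in> P" and wP: "w \<in> P" "w \<noteq> unit_dir a"
    using adj by (auto simp: ccw_adjacent_def)
  have ex: "\<exists>b. consec a b" if a: "unit_dir a \<in> P" for a
  proof -
    have "card P \<ge> 2"
      using assms(2,3) by simp
    then obtain b where "a < b" "b < a + 2 * pi" "unit_dir b \<in> P"
      "\<And>c. a < c \<Longrightarrow> c < b \<Longrightarrow> unit_dir c \<notin> P"
      using next_angle_exists[OF assms(1) _ assms(4) a] by blast
    then show ?thesis
      unfolding consec_def using a by blast
  qed
  have gap: "b - a = g \<or> b - a = 2 * pi - g" "0 < g" "g \<le> pi" if "consec a b" for a b
  proof -
    have ab: "0 < (b - a) / 2" "(b - a) / 2 < pi"
      using that by (auto simp: consec_def)
    then have pos: "0 < sin ((b - a) / 2)"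
      by (rule sin_gt_zero)
    have "ccw_adjacent P (unit_dir a) (unit_dir b)"
      using that ccw_adjacent_unit_dir_iff[of a P b] assms(4) by (auto simp: consec_def)
    then have s: "sin ((b - a) / 2) = s / 2"
      using side dist_unit_dir[of a b] pos by fastforce
    then have s01: "0 < s / 2" "s / 2 \<le> 1"
      using pos sin_le_one[of "(b - a) / 2"] by (simp_all only:)
    then have "0 < arcsin (s / 2)" "arcsin (s / 2) \<le> pi / 2"
      using arcsin_less_arcsin[of 0 "s / 2"] arcsin_ubound[of "s / 2"] by simp_all
    then show "0 < g" "g \<le> pi"
      by (auto simp: g_def)
    have "sin ((b - a) / 2) = sin (g / 2)"
      using s s01 by (simp add: g_def)
    from sin_eq_imp_angle[OF ab this] show "b - a = g \<or> b - a = 2 * pi - g"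
      using \<open>0 < g\<close> \<open>g \<le> pi\<close> by auto
  qed
  have g: "0 < g" "g \<le> pi"
    using ex[OF aP] gap by blast+
  have gap_eq: "b = a + g" if ab: "consec a b" for a b
  proof (rule ccontr)
    assume "b \<noteq> a + g"
    then have b: "b = a + 2 * pi - g"
      using gap(1)[OF ab] by auto
    \<comment> \<open>After a gap of \<open>2 * pi - g\<close> only an arc of length
      \<open>g\<close> remains before \<open>a + 2 * pi\<close>, and since \<open>p >= 3\<close> a
      third vertex must lie strictly inside it.\<close>
    have "\<not> P \<subseteq> {unit_dir a, unit_dir b}"
    proof
      assume "P \<subseteq> {unit_dir a, unit_dir b}"
      then have "card P \<le> card {unit_dir a, unit_dir b}"
        by (intro card_mono) auto
      then show False
        using assms(2,3) by (simp add: card_insert_if split: if_splits)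
    qed
    then obtain x where x: "x \<in> P" "x \<noteq> unit_dir a" "x \<noteq> unit_dir b"
      by auto
    then have "norm x = 1"
      using assms(4) by auto
    then obtain c where c: "a \<le> c" "c < a + 2 * pi" "x = unit_dir c"
      using unit_dir_surj by metis
    have "b < c"
    proof -
      have "c \<noteq> a" "c \<noteq> b"
        using c x by auto
      moreover have "\<not> (a < c \<and> c < b)"
        using ab c x unfolding consec_def by blast
      ultimately show ?thesis
        using c by linarith
    qed
    have "unit_dir b \<in> P"
      using ab by (simp add: consec_def)
    then obtain d where d: "consec b d"
      using ex by blast
    then have "d \<le> c"
      using \<open>b < c\<close> c x unfolding consec_def by (meson not_less)
    \<comment> \<open>As \<open>g \<le> pi\<close>, both possible gaps are at least
      \<open>g\<close>, so the successor \<open>d\<close> of \<open>b\<close> would reach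
      \<open>a + 2 * pi\<close> and lie beyond \<open>c\<close>.\<close>
    moreover have "d - b \<ge> g"
      using gap[OF d] by auto
    ultimately show False
      using b c by simp
  qed
  have step: "consec a (a + g)" if "unit_dir a \<in> P" for a
    using ex[OF that] gap_eq by blast
  have multiples: "unit_dir (a + real j * g) \<in> P" for j
  proof (induction j)
    case 0
    then show ?case
      using aP by simp
  next
    case (Suc j)
    then show ?case
      using step[OF Suc] by (simp add: consec_def algebra_simps)
  qed
  have onlymult: "\<exists>j::nat. c = a + real j * g" if "a \<le> c" "unit_dir c \<in> P" for c
  proof -
    \<comment> \<open>Rounding down puts \<open>c\<close> in a half-open interval between successive
      multiples; its interior contains no vertex, so \<open>c\<close> is the left end.\<close>
    define j where "j = nat \<lfloor>(c - a) / g\<rfloor>"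
    have "real j = of_int \<lfloor>(c - a) / g\<rfloor>"
      using that g by (simp add: j_def)
    then have "real j \<le> (c - a) / g" "(c - a) / g < real j + 1"
      by linarith+
    then have j: "a + real j * g \<le> c" "c < a + real j * g + g"
      using g by (simp_all add: pos_le_divide_eq pos_divide_less_eq algebra_simps)
    then have "\<not> a + real j * g < c"
      using step[OF multiples[of j]] that unfolding consec_def by blast
    then have "c = a + real j * g"
      using j by linarith
    then show ?thesis ..
  qed
  \<comment> \<open>The angle \<open>a + 2 * pi\<close> gives the starting vertex again, so a full
    turn consists of a whole number of gaps.\<close>
  obtain n where n: "2 * pi = real n * g"
    using onlymult[of "a + 2 * pi"] aP by auto
  \<comment> \<open>The first \<open>n\<close> multiples fill exactly one turn, hence list
    \<open>P\<close> without repetition, and \<open>n = p\<close> follows by counting.\<close>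
  have "P = unit_dir ` (\<lambda>j. a + real j * g) ` {..<n}"
  proof
    show "P \<subseteq> unit_dir ` (\<lambda>j. a + real j * g) ` {..<n}"
    proof
      fix x assume x: "x \<in> P"
      then have "norm x = 1"
        using assms(4) by auto
      then obtain c where c: "a \<le> c" "c < a + 2 * pi" "x = unit_dir c"
        using unit_dir_surj by metis
      then obtain j where j: "c = a + real j * g"
        using onlymult x by blast
      then have "real j * g < real n * g"
        using c n by simp
      then have "j < n"
        using g by simp
      then show "x \<in> unit_dir ` (\<lambda>j. a + real j * g) ` {..<n}"
        using c j by auto
    qed
  qed (use multiples in auto)
  moreover have "inj_on unit_dir ((\<lambda>j. a + real j * g) ` {..<n})"
  proof (rule inj_on_subset[OF inj_on_unit_dir[of a]])
    show "(\<lambda>j. a + real j * g) ` {..<n} \<subseteq> {a..<a + 2 * pi}"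
      using g n by auto
  qed
  moreover have "inj_on (\<lambda>j. a + real j * g) {..<n}"
    using g by (simp add: inj_on_def)
  ultimately have "card P = n"
    by (simp add: card_image)
  then have g_eq: "g = 2 * pi / real p"
    using n assms(2,3) by (simp add: field_simps)
  have "norm w = 1"
    using wP assms(4) by auto
  then obtain c where c: "a \<le> c" "c < a + 2 * pi" "w = unit_dir c"
    using unit_dir_surj by metis
  then have "a < c"
    using wP by (cases "a = c") auto
  then have "consec a c"
    using c adj aP wP ccw_adjacent_unit_dir_iff[of a P c] assms(4) by (auto simp: consec_def)
  then show ?thesis
    using gap_eq c g_eq by simp
qed

lemma consecutive_vertices_regular:
  assumes "regular_polygon p P" "P \<subseteq> sphere 0 1" "consecutive_vertices P k v"
  obtains a where "\<And>j. j \<le> k \<Longrightarrow> v j = unit_dir (a + real j * (2 * pi / real p))"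
proof -
  have P: "finite P" "card P = p" "p \<ge> 3"
    using assms(1) by (auto simp: regular_polygon_def convex_polygon_def)
  obtain s where s: "\<And>u w. ccw_adjacent P u w \<Longrightarrow> dist u w = s"
    using assms(1) by (auto simp: regular_polygon_def)
  have "norm (v 0) = 1"
    using assms(2,3) by (auto simp: consecutive_vertices_def)
  then obtain a where a: "v 0 = unit_dir a"
    using unit_dir_surj by metis
  have "v j = unit_dir (a + real j * (2 * pi / real p))" if "j \<le> k" for j
    using that
  proof (induction j)
    case 0
    then show ?case
      by (simp add: a)
  next
    case (Suc j)
    then have "ccw_adjacent P (unit_dir (a + real j * (2 * pi / real p))) (v (Suc j))"
      using assms(3) unfolding consecutive_vertices_def by (metis Suc_le_lessD Suc_leD)
    then have "v (Suc j) = unit_dir (a + real j * (2 * pi / real p) + 2 * pi / real p)"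
      using equilateral_inscribed_gap[OF P assms(2) s] by blast
    then show ?case
      by (simp add: algebra_simps add_divide_distrib)
  qed
  then show thesis
    using that by blast
qed

section \<open>Determinants of equally spaced unit vectors\<close>

lemma sin_le_sin_multiple:
  assumes "0 < m" "m < n"
  shows "sin (pi / real n) \<le> sin (real m * (pi / real n))"
proof -
  define g where "g = pi / real n"
  have g: "0 < g" "real n * g = pi"
    using assms by (auto simp: g_def)
  have lo: "g \<le> real m * g"
    using assms g by simp
  have "real (m + 1) * g \<le> real n * g"
    using assms g by (intro mult_right_mono) auto
  then have hi: "real m * g \<le> pi - g"
    using g by (simp add: algebra_simps)
  \<comment> \<open>From \<open>g\<close> to \<open>pi - g\<close> the sine stays at least
    \<open>sin g\<close>: it increases up to \<open>pi / 2\<close>, and the reflection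
    \<open>sin (pi - x) = sin x\<close> handles the other half.\<close>
  have "sin g \<le> sin (real m * g)"
  proof (cases "real m * g \<le> pi / 2")
    case True
    then show ?thesis
      using lo g(1) pi_ge_zero by (intro sin_monotone_2pi_le) linarith+
  next
    case False
    then have "sin g \<le> sin (pi - real m * g)"
      using lo hi g(1) pi_ge_zero by (intro sin_monotone_2pi_le) linarith+
    then show ?thesis
      by simp
  qed
  then show ?thesis
    by (simp add: g_def)
qed

text \<open>The determinant depends only on the index difference, which lies between 1 and
  \<open>k\<close>, so all angles between the vectors are proper multiples of \<open>g\<close> below
  \<open>pi\<close>. The resulting positive lower bound also shows that the vectors are
  distinct.\<close>

lemma min_det_consecutive:
  assumes "k \<ge> 1" and v: "\<And>j. j \<le> k \<Longrightarrow> v j = unit_dir (a + real j * (pi / real (k + 1)))"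
  shows "unit_vector_set (k + 1) (v ` {0..k})"
    and "min_det (v ` {0..k}) = sin (pi / real (k + 1))"
proof -
  define g where "g = pi / real (k + 1)"
  have g: "0 < g" "real (k + 1) * g = pi"
    by (simp_all add: g_def)
  have det: "\<bar>det_cols (v i) (v j)\<bar> = \<bar>sin (real (j - i) * g)\<bar>" if "i < j" "j \<le> k" for i j
    using that by (simp add: v[folded g_def] det_cols_unit_dir of_nat_diff left_diff_distrib
        del: of_nat_add of_nat_Suc)
  have pos: "0 < sin g"
    using g assms(1) by (intro sin_gt_zero) (auto simp: g_def divide_less_eq)
  have ge: "sin g \<le> \<bar>det_cols (v i) (v j)\<bar>" if "i < j" "j \<le> k" for i j
  proof -
    have "sin g \<le> sin (real (j - i) * g)"
      unfolding g_def using that by (intro sin_le_sin_multiple) auto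
    then show ?thesis
      unfolding det[OF that] by linarith
  qed
  have "v i \<noteq> v j" if "i < j" "j \<le> k" for i j
  proof
    assume "v i = v j"
    then have "det_cols (v i) (v j) = 0"
      by (simp add: det_cols_eq)
    then show False
      using ge[OF that] pos by simp
  qed
  then have inj: "inj_on v {0..k}"
    by (intro linorder_inj_onI) auto
  then show "unit_vector_set (k + 1) (v ` {0..k})"
    unfolding unit_vector_set_def by (auto simp: card_image) (simp add: v)
  have "Min {\<bar>det_cols (v i) (v j)\<bar> | i j. 0 \<le> i \<and> i < j \<and> j \<le> k} = sin g"
  proof (rule Min_eqI)
    show "finite {\<bar>det_cols (v i) (v j)\<bar> | i j. 0 \<le> i \<and> i < j \<and> j \<le> k}"
      by (rule finite_subset[of _ "(\<lambda>(i, j). \<bar>det_cols (v i) (v j)\<bar>) ` ({0..k} \<times> {0..k})"]) auto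
    show "sin g \<le> d" if "d \<in> {\<bar>det_cols (v i) (v j)\<bar> | i j. 0 \<le> i \<and> i < j \<and> j \<le> k}" for d
      using that ge by auto
    \<comment> \<open>The lower bound is attained by a neighbouring pair, which exists because
      \<open>k \<ge> 1\<close>.\<close>
    have "\<bar>det_cols (v 0) (v 1)\<bar> = sin g"
      using det[of 0 1] assms(1) pos by simp
    then show "sin g \<in> {\<bar>det_cols (v i) (v j)\<bar> | i j. 0 \<le> i \<and> i < j \<and> j \<le> k}"
      using assms(1) by (intro CollectI exI[of _ 0] exI[of _ 1]) auto
  qed
  then show "min_det (v ` {0..k}) = sin (pi / real (k + 1))"
    by (simp add: min_det_indexed[OF inj] g_def)
qed

theorem theorem15:
  fixes k :: nat
  assumes "k \<ge> 2"
  shows "(\<forall>V. unit_vector_set (k + 1) V \<longrightarrow> min_det V \<le> sin (pi / real (k + 1))) \<and>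
    (\<forall>P v. regular_polygon (2 * k + 2) P \<and> P \<subseteq> sphere 0 1 \<and> consecutive_vertices P k v \<longrightarrow>
       is_arg_max min_det (unit_vector_set (k + 1)) (v ` {0..k}) \<and>
       min_det (v ` {0..k}) = sin (pi / real (k + 1)))"
proof (intro conjI allI impI)
  show bound: "min_det V \<le> sin (pi / real (k + 1))" if "unit_vector_set (k + 1) V" for V
    using min_det_le_sin[OF assms that] .
  fix P v
  assume P: "regular_polygon (2 * k + 2) P \<and> P \<subseteq> sphere 0 1 \<and> consecutive_vertices P k v"
  then obtain a where a: "\<And>j. j \<le> k \<Longrightarrow> v j = unit_dir (a + real j * (2 * pi / real (2 * k + 2)))"
    using consecutive_vertices_regular by blast
  \<comment> \<open>The \<open>2 * k + 2\<close> sides halve to \<open>k + 1\<close> steps per half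
    turn, so the chosen vertices are equally spaced modulo \<open>pi\<close>.\<close>
  have "2 * pi / real (2 * k + 2) = pi / real (k + 1)"
    by (simp add: field_simps)
  then have v: "\<And>j. j \<le> k \<Longrightarrow> v j = unit_dir (a + real j * (pi / real (k + 1)))"
    using a by simp
  have k: "k \<ge> 1"
    using assms by simp
  show eq: "min_det (v ` {0..k}) = sin (pi / real (k + 1))"
    using min_det_consecutive(2)[OF k v] by simp
  show "is_arg_max min_det (unit_vector_set (k + 1)) (v ` {0..k})"
    using min_det_consecutive(1)[OF k v] bound by (auto simp: is_arg_max_def eq not_less)
qed

end
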